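(* $\mathbf{MEA}$ is closed under each of the rules $\mathsf{HMR_{Nt}}$, $\mathsf{HMR_{W1}}$, $\mathsf{HMR_{W2}}$ and $\mathsf{HMR_{W3}}$; that is, for every $R(x,y)$ of the form $f(x,y)=0$ with $f$ a binary primitive recursive function symbol: (Nt) if $\vdash_{\mathbf{MEA}}\Diamond P\forall x\neg\Diamond P\neg\exists yR(x,y)$ then $\vdash_{\mathbf{MEA}}\Diamond P\forall x\exists yR(x,y)$; (W1) if $\vdash_{\mathbf{MEA}}\Diamond\forall x\Diamond P\exists yR(x,y)$ then $\vdash_{\mathbf{MEA}}\Diamond P\forall x\exists yR(x,y)$; (W2) if $\vdash_{\mathbf{MEA}}\Box\forall x\neg\Diamond P\neg\exists yR(x,y)$ then $\vdash_{\mathbf{MEA}}\Box\forall x\exists yR(x,y)$; (W3) if $\vdash_{\mathbf{MEA}}\Box\forall x\Diamond\exists yR(x,y)$ then $\vdash_{\mathbf{MEA}}\Box\forall x\exists yR(x,y)$.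
   Context: Horsten's modal-epistemic arithmetic $\mathbf{MEA}$ has the language of Peano arithmetic (assumed to include a function symbol for each primitive recursive function) extended by two primitive unary operators $\Box$ and $P$; $\neg A:=A\supset\bot$ and $\Diamond A:=\neg\Box\neg A$. It is given by a Hilbert-style classical first-order calculus with equality, the axioms of Peano arithmetic (induction for all formulas of the extended language), and: M*1 $\Box A\supset A$; M*2 $(\Box A\wedge\Box(A\supset B))\supset\Box B$; M*3 from $A$ infer $\Box A$; M*4 $\Diamond A\supset\Box\Diamond A$; M*5 $\Diamond A\supset A$ for $A$ containing neither $\Box$ nor $P$; M*6 $\Diamond\exists xA\supset\exists x\Diamond A$; E*1 $PA\supset A$; E*2 $PA\supset PPA$; ME*1 from $A$ infer $\Diamond PA$; ME*2 $(\Diamond PA\wedge\Diamond P(A\supset B))\supset\Diamond PB$. *)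

theory Defs
  imports Main
begin

text \<open>One symbol for each description of a primitive recursive function. The number in \<open>Comp\<close> is the
  arity of the composite, so that nullary functions can be composed as well. \<open>Prec\<close> recurses on its
  first argument. Addition and multiplication are among these symbols, for instance
  \<open>add = Prec (Proj 1 0) (Comp 3 Succ [Proj 3 1])\<close> and
  \<open>mult = Prec (Comp 1 Zero []) (Comp 3 add [Proj 3 1, Proj 3 2])\<close>.\<close>

datatype pr =
    Zero
  | Succ
  | Proj nat nat
  | Comp nat pr "pr list"
  | Prec pr pr

inductive has_arity :: "pr \<Rightarrow> nat \<Rightarrow> bool" where
  Zero: "has_arity Zero 0"
| Succ: "has_arity Succ 1"
| Proj: "i < n \<Longrightarrow> has_arity (Proj n i) n"
| Comp: "has_arity g (length hs) \<Longrightarrow> (\<And>h. h \<in> set hs \<Longrightarrow> has_arity h n)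
    \<Longrightarrow> has_arity (Comp n g hs) n"
| Prec: "has_arity g n \<Longrightarrow> has_arity h (n + 2) \<Longrightarrow> has_arity (Prec g h) (n + 1)"

text \<open>Variables are de Bruijn indices.\<close>

datatype tm = Var nat | App pr "tm list"

abbreviation zero :: tm ("\<^bold>0") where
  "\<^bold>0 \<equiv> App Zero []"

abbreviation suc :: "tm \<Rightarrow> tm" where
  "suc t \<equiv> App Succ [t]"

datatype fm =
    Eq tm tm   (infix "\<^bold>=" 70)
  | Bot        ("\<^bold>\<bottom>")
  | Imp fm fm  (infixr "\<^bold>\<longrightarrow>" 45)
  | And fm fm  (infixr "\<^bold>\<and>" 55)
  | Or fm fm   (infixr "\<^bold>\<or>" 50)
  | All fm     ("\<^bold>\<forall> _" [65] 65)
  | Ex fm      ("\<^bold>\<exists> _" [65] 65)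
  | Box fm     ("\<box> _" [65] 65)
  | Prv fm     ("\<P> _" [65] 65)

abbreviation Neg :: "fm \<Rightarrow> fm" ("\<^bold>\<not> _" [65] 65) where
  "\<^bold>\<not> A \<equiv> A \<^bold>\<longrightarrow> \<^bold>\<bottom>"

abbreviation Dia :: "fm \<Rightarrow> fm" ("\<diamond> _" [65] 65) where
  "\<diamond> A \<equiv> \<^bold>\<not> \<box> \<^bold>\<not> A"

fun wf_tm :: "tm \<Rightarrow> bool" where
  "wf_tm (Var n) = True"
| "wf_tm (App f ts) = (has_arity f (length ts) \<and> (\<forall>t \<in> set ts. wf_tm t))"

fun wf_fm :: "fm \<Rightarrow> bool" where
  "wf_fm (s \<^bold>= t) = (wf_tm s \<and> wf_tm t)"
| "wf_fm \<^bold>\<bottom> = True"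
| "wf_fm (A \<^bold>\<longrightarrow> B) = (wf_fm A \<and> wf_fm B)"
| "wf_fm (A \<^bold>\<and> B) = (wf_fm A \<and> wf_fm B)"
| "wf_fm (A \<^bold>\<or> B) = (wf_fm A \<and> wf_fm B)"
| "wf_fm (\<^bold>\<forall> A) = wf_fm A"
| "wf_fm (\<^bold>\<exists> A) = wf_fm A"
| "wf_fm (\<box> A) = wf_fm A"
| "wf_fm (\<P> A) = wf_fm A"

fun arithmetical :: "fm \<Rightarrow> bool" where
  "arithmetical (s \<^bold>= t) = True"
| "arithmetical \<^bold>\<bottom> = True"
| "arithmetical (A \<^bold>\<longrightarrow> B) = (arithmetical A \<and> arithmetical B)"
| "arithmetical (A \<^bold>\<and> B) = (arithmetical A \<and> arithmetical B)"
| "arithmetical (A \<^bold>\<or> B) = (arithmetical A \<and> arithmetical B)"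
| "arithmetical (\<^bold>\<forall> A) = arithmetical A"
| "arithmetical (\<^bold>\<exists> A) = arithmetical A"
| "arithmetical (\<box> A) = False"
| "arithmetical (\<P> A) = False"

fun subst_tm :: "(nat \<Rightarrow> tm) \<Rightarrow> tm \<Rightarrow> tm" where
  "subst_tm \<sigma> (Var n) = \<sigma> n"
| "subst_tm \<sigma> (App f ts) = App f (map (subst_tm \<sigma>) ts)"

definition under_binder :: "(nat \<Rightarrow> tm) \<Rightarrow> nat \<Rightarrow> tm" where
  "under_binder \<sigma> = case_nat (Var 0) (\<lambda>n. subst_tm (\<lambda>m. Var (Suc m)) (\<sigma> n))"

fun subst_fm :: "(nat \<Rightarrow> tm) \<Rightarrow> fm \<Rightarrow> fm" where
  "subst_fm \<sigma> (s \<^bold>= t) = (subst_tm \<sigma> s \<^bold>= subst_tm \<sigma> t)"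
| "subst_fm \<sigma> \<^bold>\<bottom> = \<^bold>\<bottom>"
| "subst_fm \<sigma> (A \<^bold>\<longrightarrow> B) = (subst_fm \<sigma> A \<^bold>\<longrightarrow> subst_fm \<sigma> B)"
| "subst_fm \<sigma> (A \<^bold>\<and> B) = (subst_fm \<sigma> A \<^bold>\<and> subst_fm \<sigma> B)"
| "subst_fm \<sigma> (A \<^bold>\<or> B) = (subst_fm \<sigma> A \<^bold>\<or> subst_fm \<sigma> B)"
| "subst_fm \<sigma> (\<^bold>\<forall> A) = \<^bold>\<forall> (subst_fm (under_binder \<sigma>) A)"
| "subst_fm \<sigma> (\<^bold>\<exists> A) = \<^bold>\<exists> (subst_fm (under_binder \<sigma>) A)"
| "subst_fm \<sigma> (\<box> A) = \<box> (subst_fm \<sigma> A)"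
| "subst_fm \<sigma> (\<P> A) = \<P> (subst_fm \<sigma> A)"

text \<open>\<open>inst t A\<close> replaces the variable with index 0 by \<open>t\<close> and lowers the other indices, as when the
  quantifier in front of \<open>A\<close> is removed; \<open>shift A\<close> is \<open>A\<close> put under a further quantifier that does
  not bind anything in it; \<open>inst_suc A\<close> is \<open>A(x + 1)\<close> for the variable \<open>x\<close> with index 0, which
  stays in place.\<close>

definition inst :: "tm \<Rightarrow> fm \<Rightarrow> fm" where
  "inst t A = subst_fm (case_nat t Var) A"

definition shift :: "fm \<Rightarrow> fm" where
  "shift A = subst_fm (\<lambda>n. Var (Suc n)) A"

definition inst_suc :: "fm \<Rightarrow> fm" where
  "inst_suc A = subst_fm (case_nat (suc (Var 0)) (\<lambda>n. Var (Suc n))) A"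

text \<open>The defining equations of the primitive recursive function symbols. The symbols \<open>Zero\<close> and
  \<open>Succ\<close> have none.\<close>

inductive PrAxiom :: "fm \<Rightarrow> bool" where
  "i < n \<Longrightarrow> length ts = n \<Longrightarrow> PrAxiom (App (Proj n i) ts \<^bold>= ts ! i)"
| "length ts = n \<Longrightarrow> PrAxiom (App (Comp n g hs) ts \<^bold>= App g (map (\<lambda>h. App h ts) hs))"
| "PrAxiom (App (Prec g h) (\<^bold>0 # ts) \<^bold>= App g ts)"
| "PrAxiom (App (Prec g h) (suc t # ts) \<^bold>= App h (t # App (Prec g h) (t # ts) # ts))"

text \<open>All schemata, in particular \<open>AllE\<close>, \<open>Leibniz\<close> and \<open>Induct\<close>, range over the formulas of the
  extended language. Instances with arity errors are excluded below.\<close>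

inductive Axiom :: "fm \<Rightarrow> bool" where
  K: "Axiom (A \<^bold>\<longrightarrow> B \<^bold>\<longrightarrow> A)"
| S: "Axiom ((A \<^bold>\<longrightarrow> B \<^bold>\<longrightarrow> C) \<^bold>\<longrightarrow> (A \<^bold>\<longrightarrow> B) \<^bold>\<longrightarrow> A \<^bold>\<longrightarrow> C)"
| ConjI: "Axiom (A \<^bold>\<longrightarrow> B \<^bold>\<longrightarrow> A \<^bold>\<and> B)"
| ConjE1: "Axiom (A \<^bold>\<and> B \<^bold>\<longrightarrow> A)"
| ConjE2: "Axiom (A \<^bold>\<and> B \<^bold>\<longrightarrow> B)"
| DisjI1: "Axiom (A \<^bold>\<longrightarrow> A \<^bold>\<or> B)"
| DisjI2: "Axiom (B \<^bold>\<longrightarrow> A \<^bold>\<or> B)"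
| DisjE: "Axiom ((A \<^bold>\<longrightarrow> C) \<^bold>\<longrightarrow> (B \<^bold>\<longrightarrow> C) \<^bold>\<longrightarrow> A \<^bold>\<or> B \<^bold>\<longrightarrow> C)"
| DNE: "Axiom (\<^bold>\<not> \<^bold>\<not> A \<^bold>\<longrightarrow> A)"
| AllE: "wf_tm t \<Longrightarrow> Axiom (\<^bold>\<forall> A \<^bold>\<longrightarrow> inst t A)"
| AllI: "Axiom (\<^bold>\<forall> (shift A \<^bold>\<longrightarrow> B) \<^bold>\<longrightarrow> A \<^bold>\<longrightarrow> \<^bold>\<forall> B)"
| ExI: "wf_tm t \<Longrightarrow> Axiom (inst t A \<^bold>\<longrightarrow> \<^bold>\<exists> A)"
| ExE: "Axiom (\<^bold>\<forall> (A \<^bold>\<longrightarrow> shift B) \<^bold>\<longrightarrow> \<^bold>\<exists> A \<^bold>\<longrightarrow> B)"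
| Refl: "Axiom (t \<^bold>= t)"
| Leibniz: "wf_tm s \<Longrightarrow> wf_tm t \<Longrightarrow> Axiom (s \<^bold>= t \<^bold>\<longrightarrow> inst s A \<^bold>\<longrightarrow> inst t A)"
| SucNotZero: "Axiom (\<^bold>\<not> (suc t \<^bold>= \<^bold>0))"
| SucInject: "Axiom (suc s \<^bold>= suc t \<^bold>\<longrightarrow> s \<^bold>= t)"
| Pr: "PrAxiom A \<Longrightarrow> Axiom A"
| Induct: "Axiom (inst \<^bold>0 A \<^bold>\<longrightarrow> \<^bold>\<forall> (A \<^bold>\<longrightarrow> inst_suc A) \<^bold>\<longrightarrow> \<^bold>\<forall> A)"
| M1: "Axiom (\<box> A \<^bold>\<longrightarrow> A)"
| M2: "Axiom (\<box> A \<^bold>\<and> \<box> (A \<^bold>\<longrightarrow> B) \<^bold>\<longrightarrow> \<box> B)"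
| M4: "Axiom (\<diamond> A \<^bold>\<longrightarrow> \<box> \<diamond> A)"
| M5: "arithmetical A \<Longrightarrow> Axiom (\<diamond> A \<^bold>\<longrightarrow> A)"
| M6: "Axiom (\<diamond> \<^bold>\<exists> A \<^bold>\<longrightarrow> \<^bold>\<exists> \<diamond> A)"
| E1: "Axiom (\<P> A \<^bold>\<longrightarrow> A)"
| E2: "Axiom (\<P> A \<^bold>\<longrightarrow> \<P> \<P> A)"
| ME2: "Axiom (\<diamond> \<P> A \<^bold>\<and> \<diamond> \<P> (A \<^bold>\<longrightarrow> B) \<^bold>\<longrightarrow> \<diamond> \<P> B)"

text \<open>Only theorems are derivable, there are no open assumptions, so that generalisation and the two
  necessitation rules apply without side conditions.\<close>

inductive MEA :: "fm \<Rightarrow> bool" ("\<turnstile> _" [40] 40) where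
  Axiom: "Axiom A \<Longrightarrow> wf_fm A \<Longrightarrow> \<turnstile> A"
| MP: "\<turnstile> A \<^bold>\<longrightarrow> B \<Longrightarrow> \<turnstile> A \<Longrightarrow> \<turnstile> B"
| Gen: "\<turnstile> A \<Longrightarrow> \<turnstile> \<^bold>\<forall> A"
| M3: "\<turnstile> A \<Longrightarrow> \<turnstile> \<box> A"
| ME1: "\<turnstile> A \<Longrightarrow> \<turnstile> \<diamond> \<P> A"

text \<open>The formula \<open>R(x, y)\<close>, that is \<open>f(x, y) = 0\<close>, for use under \<open>\<forall>x \<dots> \<exists>y\<close>: the index of \<open>x\<close> is 1
  and that of \<open>y\<close> is 0.\<close>

abbreviation R :: "pr \<Rightarrow> fm" where
  "R f \<equiv> App f [Var 1, Var 0] \<^bold>= \<^bold>0"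

end

theory Submission
  imports Defs
begin

text \<open>Erasing all occurrences of \<open>\<box>\<close> and \<open>\<P>\<close> maps every axiom of MEA to a theorem of Peano
  arithmetic and commutes with the rules. Hence the erasure of a theorem is again a theorem. Each of
  the four hypotheses erases to \<open>\<forall>x \<exists>y R(x, y)\<close> with some double negations inserted, so
  \<open>\<forall>x \<exists>y R(x, y)\<close> is derivable, and necessitation restores the operator in front.\<close>

fun erase :: "fm \<Rightarrow> fm" where
  "erase (s \<^bold>= t) = (s \<^bold>= t)"
| "erase \<^bold>\<bottom> = \<^bold>\<bottom>"
| "erase (A \<^bold>\<longrightarrow> B) = (erase A \<^bold>\<longrightarrow> erase B)"
| "erase (A \<^bold>\<and> B) = (erase A \<^bold>\<and> erase B)"
| "erase (A \<^bold>\<or> B) = (erase A \<^bold>\<or> erase B)"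
| "erase (\<^bold>\<forall> A) = \<^bold>\<forall> (erase A)"
| "erase (\<^bold>\<exists> A) = \<^bold>\<exists> (erase A)"
| "erase (\<box> A) = erase A"
| "erase (\<P> A) = erase A"

lemma wf_fm_erase [simp]: "wf_fm (erase A) = wf_fm A"
  by (induction A) auto

lemma erase_subst_fm: "erase (subst_fm \<sigma> A) = subst_fm \<sigma> (erase A)"
  by (induction A arbitrary: \<sigma>) auto

lemma erase_inst [simp]: "erase (inst t A) = inst t (erase A)"
  and erase_shift [simp]: "erase (shift A) = shift (erase A)"
  and erase_inst_suc [simp]: "erase (inst_suc A) = inst_suc (erase A)"
  by (simp_all add: inst_def shift_def inst_suc_def erase_subst_fm)

lemma erase_PrAxiom: "PrAxiom A \<Longrightarrow> erase A = A"
  by (induction rule: PrAxiom.induct) auto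

lemma subst_tm_Var: "subst_tm Var t = t"
  by (induction t) (auto simp: map_idI)

lemma under_binder_Var: "under_binder Var = Var"
  by (auto simp: under_binder_def fun_eq_iff split: nat.split)

lemma subst_fm_Var: "subst_fm Var A = A"
  by (induction A) (auto simp: subst_tm_Var under_binder_Var)

lemma subst_tm_rename: "subst_tm \<sigma> (subst_tm (\<lambda>n. Var (\<rho> n)) t) = subst_tm (\<lambda>n. \<sigma> (\<rho> n)) t"
  by (induction t) auto

text \<open>These two equations carry the induction for \<open>subst_fm_rename\<close> through a
  quantifier: the inner substitution stays a renaming, and the lifts compose.\<close>

lemma under_binder_rename:
  "under_binder (\<lambda>n. Var (\<rho> n)) = (\<lambda>n. Var (case_nat 0 (\<lambda>m. Suc (\<rho> m)) n))"
  "(\<lambda>n. under_binder \<sigma> (case_nat 0 (\<lambda>m. Suc (\<rho> m)) n)) = under_binder (\<lambda>n. \<sigma> (\<rho> n))"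
  by (auto simp: under_binder_def fun_eq_iff split: nat.split)

lemma subst_fm_rename: "subst_fm \<sigma> (subst_fm (\<lambda>n. Var (\<rho> n)) A) = subst_fm (\<lambda>n. \<sigma> (\<rho> n)) A"
  by (induction A arbitrary: \<sigma> \<rho>) (simp_all add: subst_tm_rename under_binder_rename)

lemma wf_tm_rename: "wf_tm t \<Longrightarrow> wf_tm (subst_tm (\<lambda>n. Var (\<rho> n)) t)"
  by (induction t) auto

lemma wf_fm_rename: "wf_fm A \<Longrightarrow> wf_fm (subst_fm (\<lambda>n. Var (\<rho> n)) A)"
  by (induction A arbitrary: \<rho>) (simp_all add: wf_tm_rename under_binder_rename(1))

text \<open>Index 0 is fixed throughout, and every other index is raised by one and lowered again.
  Hence the bound variable itself can serve as the witness in \<open>double_neg_Ex\<close>.\<close>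

lemma inst_under_shift: "inst (Var 0) (subst_fm (under_binder (\<lambda>n. Var (Suc n))) A) = A"
proof -
  have "(\<lambda>n. case_nat (Var 0) Var (case_nat 0 (\<lambda>m. Suc (Suc m)) n)) = Var"
    by (auto simp: fun_eq_iff split: nat.split)
  then show ?thesis
    by (simp add: inst_def under_binder_rename(1) subst_fm_rename subst_fm_Var)
qed

lemma wf_fm_MEA: "\<turnstile> A \<Longrightarrow> wf_fm A"
  by (induction rule: MEA.induct) auto

lemma weaken: "\<turnstile> A \<Longrightarrow> wf_fm G \<Longrightarrow> \<turnstile> G \<^bold>\<longrightarrow> A"
  by (rule MP[OF MEA.Axiom[OF Axiom.K]]) (auto dest: wf_fm_MEA)

text \<open>With no open assumptions in the calculus, this use of \<open>S\<close> replaces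
  reasoning under a hypothesis \<open>G\<close>.\<close>

lemma MP_under: "\<turnstile> G \<^bold>\<longrightarrow> A \<^bold>\<longrightarrow> B \<Longrightarrow> \<turnstile> G \<^bold>\<longrightarrow> A \<Longrightarrow> \<turnstile> G \<^bold>\<longrightarrow> B"
  by (rule MP[OF MP[OF MEA.Axiom[OF Axiom.S, of G A B]]]) (auto dest: wf_fm_MEA)

lemma imp_trans: "\<turnstile> A \<^bold>\<longrightarrow> B \<Longrightarrow> \<turnstile> B \<^bold>\<longrightarrow> C \<Longrightarrow> \<turnstile> A \<^bold>\<longrightarrow> C"
  by (rule MP_under[OF weaken]) (auto dest: wf_fm_MEA)

lemma imp_refl: "wf_fm A \<Longrightarrow> \<turnstile> A \<^bold>\<longrightarrow> A"
  by (rule MP_under[OF MEA.Axiom[OF Axiom.K] MEA.Axiom[OF Axiom.K]]) auto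

lemma imp_swap: "\<turnstile> A \<^bold>\<longrightarrow> B \<^bold>\<longrightarrow> C \<Longrightarrow> \<turnstile> B \<^bold>\<longrightarrow> A \<^bold>\<longrightarrow> C"
  by (rule imp_trans[OF MEA.Axiom[OF Axiom.K] MP[OF MEA.Axiom[OF Axiom.S]]])
    (auto dest: wf_fm_MEA)

lemma double_neg_intro: "wf_fm A \<Longrightarrow> \<turnstile> A \<^bold>\<longrightarrow> \<^bold>\<not> \<^bold>\<not> A"
  by (rule imp_swap[OF imp_refl]) simp

lemma double_neg_elim: "wf_fm A \<Longrightarrow> \<turnstile> \<^bold>\<not> \<^bold>\<not> A \<^bold>\<longrightarrow> A"
  by (rule MEA.Axiom[OF Axiom.DNE]) simp

text \<open>The form that \<open>ME2\<close> takes after erasure, since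
  \<open>\<diamond> \<P>\<close> becomes a double negation.\<close>

lemma double_neg_MP:
  assumes "wf_fm A" "wf_fm B"
  shows "\<turnstile> \<^bold>\<not> \<^bold>\<not> A \<^bold>\<and> \<^bold>\<not> \<^bold>\<not> (A \<^bold>\<longrightarrow> B) \<^bold>\<longrightarrow> \<^bold>\<not> \<^bold>\<not> B"
proof -
  let ?G = "\<^bold>\<not> \<^bold>\<not> A \<^bold>\<and> \<^bold>\<not> \<^bold>\<not> (A \<^bold>\<longrightarrow> B)"
  have "\<turnstile> ?G \<^bold>\<longrightarrow> A" "\<turnstile> ?G \<^bold>\<longrightarrow> A \<^bold>\<longrightarrow> B"
    by (rule imp_trans[OF MEA.Axiom[OF Axiom.ConjE1] double_neg_elim]
          imp_trans[OF MEA.Axiom[OF Axiom.ConjE2] double_neg_elim]; simp add: assms)+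
  then have "\<turnstile> ?G \<^bold>\<longrightarrow> B"
    by (rule MP_under[rotated])
  then show ?thesis
    by (rule imp_trans[OF _ double_neg_intro[OF assms(2)]])
qed

text \<open>The form that \<open>M2\<close> takes after erasure.\<close>

lemma conj_MP:
  assumes "wf_fm A" "wf_fm B"
  shows "\<turnstile> A \<^bold>\<and> (A \<^bold>\<longrightarrow> B) \<^bold>\<longrightarrow> B"
  by (rule MP_under[OF MEA.Axiom[OF Axiom.ConjE2] MEA.Axiom[OF Axiom.ConjE1]])
    (simp_all add: assms)

lemma double_neg_Ex:
  assumes "wf_fm A"
  shows "\<turnstile> \<^bold>\<not> \<^bold>\<not> \<^bold>\<exists> A \<^bold>\<longrightarrow> \<^bold>\<exists> \<^bold>\<not> \<^bold>\<not> A"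
proof -
  let ?B = "\<^bold>\<not> \<^bold>\<not> subst_fm (under_binder (\<lambda>n. Var (Suc n))) A"
  have wf: "wf_fm ?B"
    using assms by (simp add: under_binder_rename(1) wf_fm_rename)
  have eq: "inst (Var 0) ?B = \<^bold>\<not> \<^bold>\<not> A"
    using inst_under_shift[of A] by (simp add: inst_def)
  have "\<turnstile> inst (Var 0) ?B \<^bold>\<longrightarrow> \<^bold>\<exists> ?B"
    by (rule MEA.Axiom[OF Axiom.ExI]) (use wf assms in \<open>simp_all only: eq wf_fm.simps wf_tm.simps\<close>)
  then have "\<turnstile> A \<^bold>\<longrightarrow> \<^bold>\<exists> ?B"
    unfolding eq by (rule imp_trans[OF double_neg_intro[OF assms]])
  then have "\<turnstile> \<^bold>\<forall> (A \<^bold>\<longrightarrow> shift (\<^bold>\<exists> \<^bold>\<not> \<^bold>\<not> A))"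
    by (auto simp: shift_def intro: MEA.Gen)
  then have "\<turnstile> \<^bold>\<exists> A \<^bold>\<longrightarrow> \<^bold>\<exists> \<^bold>\<not> \<^bold>\<not> A"
    by (rule MP[OF MEA.Axiom[OF Axiom.ExE], rotated])
      (use assms wf in \<open>simp add: shift_def\<close>)
  then show ?thesis
    by (rule imp_trans[OF double_neg_elim, rotated]) (simp add: assms)
qed

lemma MEA_erase_Axiom: "Axiom A \<Longrightarrow> wf_fm A \<Longrightarrow> \<turnstile> erase A"
proof (induction rule: Axiom.induct)
  case (Pr A)
  then show ?case
    by (simp add: erase_PrAxiom MEA.Axiom Axiom.Pr)
next
  case (AllE t A)
  then show ?case
    using MEA.Axiom[OF Axiom.AllE, of t "erase A"] wf_fm_erase[of "inst t A"] by simp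
next
  case (AllI A B)
  then show ?case
    using MEA.Axiom[OF Axiom.AllI, of "erase A" "erase B"] wf_fm_erase[of "shift A"] by simp
next
  case (ExI t A)
  then show ?case
    using MEA.Axiom[OF Axiom.ExI, of t "erase A"] wf_fm_erase[of "inst t A"] by simp
next
  case (ExE A B)
  then show ?case
    using MEA.Axiom[OF Axiom.ExE, of "erase A" "erase B"] wf_fm_erase[of "shift B"] by simp
next
  case (Leibniz s t A)
  then show ?case
    using MEA.Axiom[OF Axiom.Leibniz, of s t "erase A"]
      wf_fm_erase[of "inst s A"] wf_fm_erase[of "inst t A"] by simp
next
  case (Induct A)
  then show ?case
    using MEA.Axiom[OF Axiom.Induct, of "erase A"]
      wf_fm_erase[of "inst \<^bold>0 A"] wf_fm_erase[of "inst_suc A"] by simp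
qed (auto intro: MEA.Axiom Axiom.intros imp_refl conj_MP double_neg_MP double_neg_Ex)

lemma MEA_erase: "\<turnstile> A \<Longrightarrow> \<turnstile> erase A"
  by (induction rule: MEA.induct)
    \<comment> \<open>\<open>M3\<close> leaves the erasure unchanged, while \<open>ME1\<close> adds
      a double negation to it.\<close>
    (auto intro: MEA_erase_Axiom MEA.MP MEA.Gen MP[OF double_neg_intro] dest: wf_fm_MEA)

lemma MEA_double_negD: "\<turnstile> \<^bold>\<not> \<^bold>\<not> A \<Longrightarrow> \<turnstile> A"
  using MP double_neg_elim wf_fm_MEA by fastforce

text \<open>The second assumption says that no index other than 0 is free in \<open>A\<close>.
  Otherwise removing the quantifier with \<open>Var 0\<close> would lower index 1 to 0, and
  \<open>Gen\<close> would then bind it too.\<close>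

lemma MEA_All_double_negD:
  assumes "\<turnstile> \<^bold>\<forall> \<^bold>\<not> \<^bold>\<not> A" "inst (Var 0) A = A"
  shows "\<turnstile> \<^bold>\<forall> A"
proof -
  have "inst (Var 0) (\<^bold>\<not> \<^bold>\<not> A) = \<^bold>\<not> \<^bold>\<not> A"
    using assms(2) by (simp add: inst_def)
  moreover have "wf_fm A"
    using wf_fm_MEA[OF assms(1)] by simp
  ultimately have "\<turnstile> \<^bold>\<forall> \<^bold>\<not> \<^bold>\<not> A \<^bold>\<longrightarrow> \<^bold>\<not> \<^bold>\<not> A"
    using MEA.Axiom[OF Axiom.AllE, of "Var 0" "\<^bold>\<not> \<^bold>\<not> A"] by simp
  then show ?thesis
    by (meson MEA_double_negD MEA.Gen MP assms(1))
qed

theorem theorem7p1: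
  fixes f :: pr
  assumes "has_arity f 2"
  shows "(\<turnstile> \<diamond> \<P> \<^bold>\<forall> \<^bold>\<not> \<diamond> \<P> \<^bold>\<not> \<^bold>\<exists> (R f) \<longrightarrow> \<turnstile> \<diamond> \<P> \<^bold>\<forall> \<^bold>\<exists> (R f)) \<and>
         (\<turnstile> \<diamond> \<^bold>\<forall> \<diamond> \<P> \<^bold>\<exists> (R f) \<longrightarrow> \<turnstile> \<diamond> \<P> \<^bold>\<forall> \<^bold>\<exists> (R f)) \<and>
         (\<turnstile> \<box> \<^bold>\<forall> \<^bold>\<not> \<diamond> \<P> \<^bold>\<not> \<^bold>\<exists> (R f) \<longrightarrow> \<turnstile> \<box> \<^bold>\<forall> \<^bold>\<exists> (R f)) \<and>
         (\<turnstile> \<box> \<^bold>\<forall> \<diamond> \<^bold>\<exists> (R f) \<longrightarrow> \<turnstile> \<box> \<^bold>\<forall> \<^bold>\<exists> (R f))"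
proof -
  let ?A = "\<^bold>\<exists> (R f)"
  have inst: "inst (Var 0) ?A = ?A"
    by (simp add: inst_def under_binder_def)
  then have inst': "inst (Var 0) (\<^bold>\<not> \<^bold>\<not> ?A) = \<^bold>\<not> \<^bold>\<not> ?A"
    by (simp add: inst_def)
  \<comment> \<open>This serves (W1), once its outer double negation is removed, and (W3).\<close>
  have W: "\<turnstile> \<^bold>\<forall> ?A" if "\<turnstile> \<^bold>\<forall> \<^bold>\<not> \<^bold>\<not> ?A"
    using that inst by (rule MEA_All_double_negD)
  have Nt: "\<turnstile> \<^bold>\<forall> ?A" if "\<turnstile> \<^bold>\<forall> \<^bold>\<not> \<^bold>\<not> \<^bold>\<not> \<^bold>\<not> ?A"
    by (rule W[OF MEA_All_double_negD[OF that inst']])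
  show ?thesis
    by (intro conjI impI; drule MEA_erase)
      \<comment> \<open>\<open>ME1\<close> restores \<open>\<diamond> \<P>\<close> and
        \<open>M3\<close> restores \<open>\<box>\<close>. Keeping \<open>1\<close> unexpanded lets
        \<open>R f\<close> match \<open>W\<close> and \<open>Nt\<close>.\<close>
      (auto intro!: MEA.ME1 MEA.M3 intro: W Nt MEA_double_negD simp del: One_nat_def)
qed

end
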